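(* Let $G=(L\cup R,E)$ be a finite bipartite task assignment graph and let $G'$ be an exam result graph obtained from $G$, i.e. a directed graph on the vertex set $L\cup R$ obtained by giving each edge of $G$ exactly one of its two directions. Then Condition A holds for $G'$ if and only if $G'$ is strongly connected.
   Context: The vertices (students in $L$ and questions in $R$) are called subjects. A directed edge $i\to j$ of $G'$ is read as "subject $i$ has beaten subject $j$". Condition A: for every ordered pair $(V_1,V_2)$ of nonempty sets that form a partition of the set of subjects $L\cup R$, some subject in $V_1$ has beaten some subject in $V_2$, i.e. there is an edge of $G'$ from $V_1$ to $V_2$. (Since $(V_2,V_1)$ is also such a pair, there is an edge in each direction.) *)

theory Defs
  imports "Graph_Theory.Graph_Theory"
begin

definition task_assignment_graph :: "'a set \<Rightarrow> 'a set \<Rightarrow> 'a set set \<Rightarrow> bool" where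
  "task_assignment_graph L R E \<longleftrightarrow>
     finite L \<and> finite R \<and> L \<inter> R = {} \<and> (\<forall>e\<in>E. \<exists>i\<in>L. \<exists>j\<in>R. e = {i, j})"

(* Every arc comes from an edge, and every edge receives exactly one of its two directions;
   the disequality below is exclusive or. *)
definition exam_result_graph ::
    "'a set \<Rightarrow> 'a set \<Rightarrow> 'a set set \<Rightarrow> 'a pair_pre_digraph \<Rightarrow> bool" where
  "exam_result_graph L R E G' \<longleftrightarrow>
     pverts G' = L \<union> R \<and>
     (\<forall>(i, j)\<in>parcs G'. {i, j} \<in> E) \<and>
     (\<forall>i j. {i, j} \<in> E \<longrightarrow> ((i, j) \<in> parcs G') \<noteq> ((j, i) \<in> parcs G'))"

(* The null digraph satisfies this vacuously but is not strongly_connected in Graph_Theory,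
   so comparing the two notions requires a nonempty vertex set. *)
definition condition_A :: "('a, 'b) pre_digraph \<Rightarrow> bool" where
  "condition_A G' \<longleftrightarrow>
     (\<forall>V1 V2. V1 \<noteq> {} \<and> V2 \<noteq> {} \<and> V1 \<union> V2 = verts G' \<and> V1 \<inter> V2 = {} \<longrightarrow>
        (\<exists>i\<in>V1. \<exists>j\<in>V2. i \<rightarrow>\<^bsub>G'\<^esub> j))"

end

theory Submission
  imports Defs
begin

text \<open>A walk that starts in \<open>S\<close> and ends outside must at some point cross an arc
  out of \<open>S\<close>.\<close>

lemma reachable_leaves_set:
  assumes "u \<rightarrow>\<^sup>*\<^bsub>G\<^esub> v" "u \<in> S" "v \<notin> S"
  obtains i j where "i \<in> S" "j \<in> verts G - S" "i \<rightarrow>\<^bsub>G\<^esub> j"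
proof -
  \<comment> \<open>This disjunction is the invariant along the walk: the current endpoint is still
    in \<open>S\<close>, or a crossing arc has already been found.\<close>
  have "v \<in> S \<or> (\<exists>i\<in>S. \<exists>j\<in>verts G - S. i \<rightarrow>\<^bsub>G\<^esub> j)"
    using assms(1) unfolding reachable_def
    by (induction rule: rtrancl_on_induct) (use assms(2) in blast)+
  with assms(3) that show thesis by blast
qed

text \<open>If some vertex were not reachable from \<open>u\<close>, Condition A applied to the set of
  vertices reachable from \<open>u\<close> and its complement would yield an arc leaving that set.\<close>

lemma condition_A_imp_reachable:
  assumes A: "condition_A G" and u: "u \<in> verts G" and v: "v \<in> verts G"
  shows "u \<rightarrow>\<^sup>*\<^bsub>G\<^esub> v"
proof (rule ccontr)
  assume nv: "\<not> u \<rightarrow>\<^sup>*\<^bsub>G\<^esub> v"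
  let ?S = "{w \<in> verts G. u \<rightarrow>\<^sup>*\<^bsub>G\<^esub> w}"
  have "u \<in> ?S" using u by (simp add: reachable_def)
  moreover have "v \<in> verts G - ?S" using v nv by simp
  ultimately have "?S \<noteq> {} \<and> verts G - ?S \<noteq> {} \<and> ?S \<union> (verts G - ?S) = verts G
      \<and> ?S \<inter> (verts G - ?S) = {}" by blast
  with A obtain i j where "i \<in> ?S" "j \<in> verts G - ?S" "i \<rightarrow>\<^bsub>G\<^esub> j"
    unfolding condition_A_def by meson
  \<comment> \<open>Appending the arc to a walk from \<open>u\<close> to \<open>i\<close> makes
    \<open>j\<close> reachable, so \<open>j\<close> belongs to the set it was chosen outside
    of.\<close>
  then show False by (auto simp: reachable_def intro: rtrancl_on_into_rtrancl_on)
qed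

text \<open>The backward direction follows a walk from \<open>V1\<close> to \<open>V2\<close> to the
  arc on which it leaves \<open>V1\<close>.\<close>

lemma condition_A_iff_strongly_connected:
  assumes "verts G \<noteq> {}"
  shows "condition_A G \<longleftrightarrow> strongly_connected G"
proof
  assume "condition_A G"
  with assms show "strongly_connected G"
    by (auto intro: condition_A_imp_reachable)
next
  assume sc: "strongly_connected G"
  show "condition_A G"
    unfolding condition_A_def
  proof (intro allI impI, elim conjE)
    fix V1 V2
    assume part: "V1 \<noteq> {}" "V2 \<noteq> {}" "V1 \<union> V2 = verts G" "V1 \<inter> V2 = {}"
    then obtain u v where "u \<in> V1" "v \<in> V2" by blast
    moreover from this part sc have "u \<rightarrow>\<^sup>*\<^bsub>G\<^esub> v" "v \<notin> V1"
      unfolding strongly_connected_def by blast+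
    ultimately obtain i j where "i \<in> V1" "j \<in> verts G - V1" "i \<rightarrow>\<^bsub>G\<^esub> j"
      by (blast elim: reachable_leaves_set)
    \<comment> \<open>Since \<open>V1\<close> and \<open>V2\<close> cover the vertices, the head of
      the leaving arc lies in \<open>V2\<close>.\<close>
    with part show "\<exists>i\<in>V1. \<exists>j\<in>V2. i \<rightarrow>\<^bsub>G\<^esub> j" by blast
  qed
qed

theorem theorem9:
  fixes L R :: "'a set" and E :: "'a set set" and G' :: "'a pair_pre_digraph"
  assumes "task_assignment_graph L R E"
    and "L \<union> R \<noteq> {}"
    and "exam_result_graph L R E G'"
  shows "condition_A (with_proj G') \<longleftrightarrow> strongly_connected (with_proj G')"
proof (rule condition_A_iff_strongly_connected)
  show "verts (with_proj G') \<noteq> {}"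
    \<comment> \<open>The vertex set of an exam result graph is \<open>L \<union> R\<close>, so its
      nonemptiness is the second assumption.\<close>
    using assms(2,3) by (simp add: exam_result_graph_def)
qed

end
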